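(* Fix a Borel set $E\subset[0,1]$ and a density $g$ with support $E$. There exists a measurable map $\phi:\mathbb{R}^{\mathbb{N}}\to[0,1]^{\mathbb{N}}$ (depending only on $E$ and $g$) such that the following holds. If $(f_n)_{n\in\mathbb{N}}$ is a sequence of densities on $\mathbb{R}$ all having the same conditional density $g$ on $E$, with $$\sum_{n\in\mathbb{N}}\int_E f_n(u)\,du=\infty,$$ and the associated one-sided Bernoulli shift $(\mathbb{R}^{\mathbb{N}},\mathcal{B},\bigotimes_{n\in\mathbb{N}}f_n)$ is nonsingular, then $\phi$ is a measure-preserving factor from this nonsingular system to the i.i.d. system on $[0,1]^{\mathbb{N}}$ given by the product of Lebesgue measure restricted to the unit interval (with the left-shift).
   Context: $\mathbb{N}=\{0,1,2,\dots\}$. A density is a measurable $f:\mathbb{R}\to[0,\infty)$ with $\int_{\mathbb{R}}f(u)\,du=1$, identified with the probability measure $B\mapsto\int_B f(u)\,du$. The conditional density of $f$ on a Borel set $E$ (with $\int_E f>0$) is $\big(\int_E f(u)\,du\big)^{-1}f\mathbf{1}_E$. A one-sided Bernoulli shift is a product space $(A^{\mathbb{N}},\mathcal{B},\bigotimes_{n\in\mathbb{N}}\rho_n)$ with the left-shift $(Ta)_i=a_{i+1}$; it is nonsingular if $\mu\circ T^{-1}$ is equivalent to $\mu$ (same null sets), where $\mu=\bigotimes_n\rho_n$. A measurable map $\phi:\Omega\to\Omega'$ between systems $(\Omega,\mathcal{F},\mu,T)$ and $(\Omega',\mathcal{F}',\mu',T')$ is a measure-preserving factor if $\phi\circ T=T'\circ\phi$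 and $\mu\circ\phi^{-1}=\mu'$. *)

theory Defs
  imports "HOL-Probability.Probability"
begin

definition prob_density_fun :: "(real \<Rightarrow> real) \<Rightarrow> bool" where
  "prob_density_fun f \<longleftrightarrow>
     f \<in> borel_measurable borel \<and> (\<forall>u. 0 \<le> f u) \<and> has_bochner_integral lborel f 1"

(* Densities are identified with the measures they define, so the set where a density is
   positive, as well as equality of densities, only makes sense up to Lebesgue-null sets. *)
definition density_has_support :: "(real \<Rightarrow> real) \<Rightarrow> real set \<Rightarrow> bool" where
  "density_has_support g E \<longleftrightarrow> (AE u in lborel. g u \<noteq> 0 \<longleftrightarrow> u \<in> E)"

definition cond_density :: "(real \<Rightarrow> real) \<Rightarrow> real set \<Rightarrow> real \<Rightarrow> real" where
  "cond_density f E = (\<lambda>u. inverse (LINT v:E|lborel. f v) * (f u * indicator E u))"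

definition has_cond_density :: "(real \<Rightarrow> real) \<Rightarrow> real set \<Rightarrow> (real \<Rightarrow> real) \<Rightarrow> bool" where
  "has_cond_density f E g \<longleftrightarrow>
     (LINT v:E|lborel. f v) > 0 \<and> (AE u in lborel. cond_density f E u = g u)"

definition left_shift :: "(nat \<Rightarrow> 'a) \<Rightarrow> nat \<Rightarrow> 'a" where
  "left_shift a = (\<lambda>i. a (Suc i))"

definition bernoulli_measure :: "(nat \<Rightarrow> real \<Rightarrow> real) \<Rightarrow> (nat \<Rightarrow> real) measure" where
  "bernoulli_measure f = (\<Pi>\<^sub>M n\<in>UNIV. density lborel (\<lambda>u. ennreal (f n u)))"

definition iid_uniform_measure :: "(nat \<Rightarrow> real) measure" where
  "iid_uniform_measure = (\<Pi>\<^sub>M n\<in>UNIV. restrict_space lborel {0..1})"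

definition nonsingular_map :: "'a measure \<Rightarrow> ('a \<Rightarrow> 'a) \<Rightarrow> bool" where
  "nonsingular_map M T \<longleftrightarrow> T \<in> M \<rightarrow>\<^sub>M M \<and> null_sets (distr M M T) = null_sets M"

(* Equivariance is required at every point, not merely almost everywhere. *)
definition measure_preserving_factor ::
    "('a \<Rightarrow> 'b) \<Rightarrow> 'a measure \<Rightarrow> ('a \<Rightarrow> 'a) \<Rightarrow> 'b measure \<Rightarrow> ('b \<Rightarrow> 'b) \<Rightarrow> bool" where
  "measure_preserving_factor \<phi> M T N S \<longleftrightarrow>
     \<phi> \<in> M \<rightarrow>\<^sub>M N \<and> (\<forall>x\<in>space M. \<phi> (T x) = S (\<phi> x)) \<and> distr M N \<phi> = N"

end

(* A visit of the sequence to E at time n carries a value with law g, and one such value encodes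
   infinitely many independent uniform numbers h_0, h_1, ...: apply the distribution function of
   g and split the binary digits into infinitely many rows.  Let phi(x)_i = h_d(x_(i+d)), where
   d is the waiting time from i to the next visit.  The factor map is equivariant by construction,
   and different i use different pairs (visit, row), so no two coordinates share randomness.

   To see that the law of phi(x) is uniform, replace the values at the visits by fresh independent
   samples y_n from g: this does not change the law of x, and given x (with infinitely many visits,
   by the divergence hypothesis) phi is a function of y alone that reads off distinct uniforms. *)

theory Submission
  imports Defs
begin

section \<open>The distribution function of an atomless law\<close>

text \<open>Probability integral transform. Without atoms the distribution function is continuous,
  so for \<open>0 \<le> t < 1\<close> a nonempty sublevel set is a half-line \<open>{..s}\<close>
  with \<open>cdf M s = t\<close>, and its mass is again \<open>t\<close>. Flat stretches do no
  harm, since \<open>s\<close> is their right end.\<close>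

lemma (in real_distribution) distr_cdf_uniform:
  assumes atomless: "\<And>x. measure M {x} = 0"
  shows "distr M borel (cdf M) = uniform_measure lborel {0..1}"
proof -
  let ?U = "uniform_measure lborel {0..1::real}"
  have cont: "isCont (cdf M) x" for x
    using atomless isCont_cdf by blast
  have cdf_borel: "cdf M \<in> borel_measurable borel"
    by (intro borel_measurable_mono monoI cdf_nondecreasing)
  have cdf_M: "cdf M \<in> M \<rightarrow>\<^sub>M borel"
    using cdf_borel by (rule measurable_finite_borel)
  interpret D: real_distribution "distr M borel (cdf M)"
    using cdf_M by (rule real_distribution_distr)
  interpret U: prob_space ?U
    by (rule prob_space_uniform_measure) auto
  interpret U: real_distribution ?U
    by standard auto
  have "cdf (distr M borel (cdf M)) t = cdf ?U t" for t
  proof -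
    have L: "cdf (distr M borel (cdf M)) t = measure M {x. cdf M x \<le> t}"
      using cdf_M by (subst cdf_def2, subst measure_distr) (auto simp: vimage_def)
    have "{0..1} \<inter> {..t} = {0..min 1 t}"
      by auto
    then have R: "cdf ?U t = measure lborel {0..min 1 t}"
      unfolding cdf_def2 by (subst measure_uniform_measure) auto
    consider "t < 0" | "1 \<le> t" | "0 \<le> t" "t < 1"
      by linarith
    then show ?thesis
    proof cases
      case 1
      then have "\<not> cdf M x \<le> t" for x
        using cdf_nonneg[of x] by linarith
      with 1 show ?thesis
        unfolding L R by simp
    next
      case 2
      then have "cdf M x \<le> t" for x
        using cdf_bounded_prob[of x] by linarith
      with 2 show ?thesis
        unfolding L R using prob_space by simp
    next
      case 3
      let ?S = "{x. cdf M x \<le> t}"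
      have "measure M ?S = t"
      proof (cases "?S = {}")
        case True
        \<comment> \<open>The distribution function tends to 0 at minus infinity, so every positive
          level has a nonempty sublevel set.\<close>
        have "t = 0"
        proof (rule ccontr)
          assume "t \<noteq> 0"
          with 3 have "\<forall>\<^sub>F x in at_bot. cdf M x < t"
            by (intro order_tendstoD(2)[OF cdf_lim_at_bot]) auto
          then obtain x where "cdf M x < t"
            by (meson eventually_happens' trivial_limit_at_bot_linorder)
          with True show False
            by (auto dest: less_imp_le)
        qed
        with True show ?thesis
          by simp
      next
        case False
        have "\<forall>\<^sub>F x in at_top. t < cdf M x"
          using 3 by (intro order_tendstoD(1)[OF cdf_lim_at_top_prob]) auto
        then obtain b where b: "t < cdf M b"
          by (meson eventually_happens' trivial_limit_at_top_linorder)
        have bdd: "bdd_above ?S"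
        proof (rule bdd_aboveI)
          fix x assume "x \<in> ?S"
          with b show "x \<le> b"
            using cdf_nondecreasing[of b x] by (cases "b \<le> x") auto
        qed
        have "closed ?S"
          by (intro closed_Collect_le continuous_on_const continuous_at_imp_continuous_on)
            (auto intro: cont)
        then have mem: "Sup ?S \<in> ?S"
          using False bdd by (intro closed_contains_Sup)
        have S: "?S = {..Sup ?S}"
        proof (intro set_eqI iffI)
          fix x assume "x \<in> {..Sup ?S}"
          then show "x \<in> ?S"
            using mem cdf_nondecreasing[of x "Sup ?S"] by auto
        qed (use bdd in \<open>auto intro: cSup_upper\<close>)
        \<comment> \<open>A value below \<open>t\<close> would, by continuity, stay below
          \<open>t\<close> just to the right of the supremum.\<close>
        have "cdf M (Sup ?S) = t"
        proof (rule ccontr)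
          assume "cdf M (Sup ?S) \<noteq> t"
          with mem have "cdf M (Sup ?S) < t"
            by simp
          then have "\<forall>\<^sub>F x in at (Sup ?S). cdf M x < t"
            using cont[of "Sup ?S"] unfolding isCont_def by (rule order_tendstoD(2)[rotated])
          then have "\<forall>\<^sub>F x in at_right (Sup ?S). cdf M x < t"
            by (rule eventually_at_split[THEN iffD1, THEN conjunct2])
          then obtain c where "c > Sup ?S" "\<And>y. y > Sup ?S \<Longrightarrow> y < c \<Longrightarrow> cdf M y < t"
            unfolding eventually_at_right_field by blast
          then obtain y where "y > Sup ?S" "cdf M y < t"
            using dense by metis
          with S show False
            by (metis (mono_tags, lifting) atMost_iff linorder_not_less mem_Collect_eq order_less_imp_le)
        qed
        then show ?thesis
          by (subst S) (simp add: cdf_def2)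
      qed
      with 3 show ?thesis
        unfolding L R by simp
    qed
  qed
  then show ?thesis
    by (intro cdf_unique D.real_distribution_axioms U.real_distribution_axioms) auto
qed

section \<open>Independent uniform numbers from binary digits\<close>

text \<open>Digits are counted from 0, so digit \<open>n\<close> has weight \<open>2^-(n+1)\<close>.
  At dyadic points of \<open>[0,1)\<close> the floor selects the expansion that ends in
  zeros.\<close>

definition binary_digit :: "nat \<Rightarrow> real \<Rightarrow> int" where
  "binary_digit n u = \<lfloor>2 ^ Suc n * u\<rfloor> mod 2"

definition binary_value :: "(nat \<Rightarrow> int) \<Rightarrow> real" where
  "binary_value b = (\<Sum>i. of_int (b i) * (1/2) ^ Suc i)"

lemma binary_digit_range: "binary_digit n u \<in> {0, 1}"
  unfolding binary_digit_def by auto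

lemma measurable_binary_digit [measurable]:
  "binary_digit n \<in> borel \<rightarrow>\<^sub>M count_space UNIV"
  unfolding binary_digit_def by measurable

text \<open>Halving commutes with taking floors. This recursion drives two inductions: the one on
  partial sums of the expansion and the one that identifies digit cylinders with dyadic
  intervals.\<close>

lemma floor_double: "\<lfloor>2 ^ Suc n * u\<rfloor> = 2 * \<lfloor>2 ^ n * u\<rfloor> + binary_digit n u" for u :: real
proof -
  have "\<lfloor>2 ^ Suc n * u\<rfloor> div 2 = \<lfloor>2 ^ n * u\<rfloor>"
    using floor_divide_real_eq_div[of 2 "2 ^ Suc n * u"] by simp
  then show ?thesis
    unfolding binary_digit_def by presburger
qed

text \<open>The partial sums are the dyadic truncations of \<open>u\<close>, which differ from
  \<open>u\<close> by at most \<open>2^-n\<close>. The bound is strict because all digits of 1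
  vanish.\<close>

lemma binary_value_binary_digit:
  assumes "0 \<le> u" "u < 1"
  shows "binary_value (\<lambda>i. binary_digit i u) = u"
proof -
  have partial: "(\<Sum>i<n. real_of_int (binary_digit i u) * (1/2) ^ Suc i) = of_int \<lfloor>2 ^ n * u\<rfloor> / 2 ^ n" for n
  proof (induction n)
    case 0
    have "\<lfloor>u\<rfloor> = 0"
      using assms by linarith
    then show ?case
      by simp
  next
    case (Suc n)
    then have "(\<Sum>i<Suc n. real_of_int (binary_digit i u) * (1/2) ^ Suc i)
        = of_int (2 * \<lfloor>2 ^ n * u\<rfloor> + binary_digit n u) / 2 ^ Suc n"
      by (simp add: field_simps)
    then show ?case
      by (simp only: floor_double)
  qed
  have "(\<lambda>n. real_of_int \<lfloor>2 ^ n * u\<rfloor> / 2 ^ n) \<longlonglongrightarrow> u"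
  proof (rule tendsto_sandwich)
    show "\<forall>\<^sub>F n in sequentially. u - (1/2) ^ n \<le> of_int \<lfloor>2 ^ n * u\<rfloor> / 2 ^ n"
    proof (rule always_eventually, rule allI)
      fix n
      have "2 ^ n * u - 1 \<le> of_int \<lfloor>2 ^ n * u\<rfloor>"
        by linarith
      then have "(2 ^ n * u - 1) / 2 ^ n \<le> of_int \<lfloor>2 ^ n * u\<rfloor> / 2 ^ n"
        by (rule divide_right_mono) simp
      then show "u - (1/2) ^ n \<le> of_int \<lfloor>2 ^ n * u\<rfloor> / 2 ^ n"
        by (simp add: diff_divide_distrib power_divide)
    qed
    show "\<forall>\<^sub>F n in sequentially. of_int \<lfloor>2 ^ n * u\<rfloor> / 2 ^ n \<le> u"
      by (rule always_eventually) (simp add: field_simps)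
    have "(\<lambda>n. u - (1/2) ^ n) \<longlonglongrightarrow> u - 0"
      by (intro tendsto_intros LIMSEQ_realpow_zero) auto
    then show "(\<lambda>n. u - (1/2) ^ n) \<longlonglongrightarrow> u"
      by simp
  qed simp
  then have "(\<lambda>i. of_int (binary_digit i u) * (1/2) ^ Suc i) sums u"
    unfolding sums_def partial .
  then show ?thesis
    unfolding binary_value_def by (rule sums_unique[symmetric])
qed

text \<open>Comparison with the geometric series. The sequence constantly 1 attains the endpoint 1,
  hence the closed interval.\<close>

lemma binary_value_bounds:
  assumes "\<And>i. b i \<in> {0, 1}"
  shows "binary_value b \<in> {0..1}"
proof -
  have geo: "(\<lambda>i. (1/2) ^ Suc i :: real) sums 1"
    using power_half_series by simp
  have le: "of_int (b i) * (1/2) ^ Suc i \<le> ((1/2) ^ Suc i :: real)"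
    and ge: "0 \<le> (of_int (b i) * (1/2) ^ Suc i :: real)" for i
    using assms[of i] by auto
  have summ: "summable (\<lambda>i. of_int (b i) * (1/2) ^ Suc i :: real)"
    using le ge by (intro summable_comparison_test'[OF sums_summable[OF geo]]) auto
  have "binary_value b \<le> 1"
    unfolding binary_value_def using suminf_le[OF le summ sums_summable[OF geo]] sums_unique[OF geo]
    by simp
  moreover have "0 \<le> binary_value b"
    unfolding binary_value_def using summ ge by (rule suminf_nonneg)
  ultimately show ?thesis
    by simp
qed

lemma measurable_binary_value [measurable]:
  "binary_value \<in> (\<Pi>\<^sub>M i\<in>UNIV. count_space UNIV) \<rightarrow>\<^sub>M borel"
proof -
  have [measurable]: "(\<lambda>b. real_of_int (b i)) \<in> (\<Pi>\<^sub>M i\<in>UNIV. count_space UNIV) \<rightarrow>\<^sub>M borel" for i :: nat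
    by (rule measurable_compose[OF measurable_component_singleton]) auto
  show ?thesis
    unfolding binary_value_def[abs_def] by measurable
qed

section \<open>The binary digits of a uniform number are independent fair coins\<close>

abbreviation unif :: "real measure" where
  "unif \<equiv> uniform_measure lborel {0..1}"

abbreviation coin :: "int measure" where
  "coin \<equiv> measure_pmf (pmf_of_set {0, 1})"

lemma emeasure_coin: "emeasure coin A = card ({0, 1} \<inter> A) / 2"
  by (subst emeasure_pmf_of_set) auto

lemma prob_space_unif: "prob_space unif"
  by (rule prob_space_uniform_measure) auto

lemma AE_unif: "AE u in unif. 0 \<le> u \<and> u < 1"
proof -
  have "AE u in lborel. u \<noteq> (1::real)"
    by (rule AE_lborel_singleton)
  then show ?thesis
    by (subst AE_uniform_measure) (auto simp: less_le)
qed

lemma emeasure_unif_dyadic: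
  fixes m :: int
  assumes "0 \<le> m" "m < 2 ^ n"
  shows "emeasure unif {u. \<lfloor>2 ^ n * u\<rfloor> = m} = ennreal (1 / 2 ^ n)"
proof -
  have eq: "{u::real. \<lfloor>2 ^ n * u\<rfloor> = m} = {of_int m / 2 ^ n ..< (of_int m + 1) / 2 ^ n}"
    by (auto simp: floor_eq_iff field_simps)
  have "of_int (m + 1) \<le> (of_int (2 ^ n) :: real)"
    using assms by (intro of_int_le_iff[THEN iffD2]) simp
  then have "(of_int m + 1) / 2 ^ n \<le> (1::real)" "0 \<le> of_int m / (2 ^ n :: real)"
    using assms by (simp_all add: field_simps)
  then have "{of_int m / 2 ^ n ..< (of_int m + 1) / 2 ^ n} \<subseteq> {0..1::real}"
    by (meson atLeastAtMost_iff atLeastLessThan_iff less_imp_le order_trans subsetI)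
  then have "{0..1} \<inter> {u::real. \<lfloor>2 ^ n * u\<rfloor> = m} = {of_int m / 2 ^ n ..< (of_int m + 1) / 2 ^ n}"
    unfolding eq by (rule Int_absorb1)
  then have "emeasure unif {u. \<lfloor>2 ^ n * u\<rfloor> = m} = emeasure lborel {of_int m / 2 ^ n ..< (of_int m + 1) / 2 ^ n :: real}"
    by (subst emeasure_uniform_measure) (simp_all add: eq divide_ennreal_def)
  also have "\<dots> = ennreal ((of_int m + 1) / 2 ^ n - of_int m / 2 ^ n)"
    by (intro emeasure_lborel_Ico divide_right_mono) simp_all
  also have "(of_int m + 1) / 2 ^ n - of_int m / 2 ^ n = 1 / (2 ^ n :: real)"
    by (simp add: add_divide_distrib)
  finally show ?thesis .
qed

text \<open>A word of length \<open>n\<close> singles out one dyadic interval of level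
  \<open>n\<close>, since each further digit chooses a half of the current interval. Digits ignore
  the integer part, so \<open>\<lfloor>u\<rfloor> = 0\<close> is what confines \<open>u\<close> to
  \<open>[0,1)\<close>.\<close>

lemma emeasure_unif_digits:
  assumes "\<And>i. w i \<in> {0, 1::int}"
  shows "emeasure unif {u. \<lfloor>u\<rfloor> = 0 \<and> (\<forall>i<n. binary_digit i u = w i)} = ennreal (1 / 2 ^ n)"
proof -
  have "\<exists>m. 0 \<le> m \<and> m < 2 ^ n \<and>
      {u::real. \<lfloor>u\<rfloor> = 0 \<and> (\<forall>i<n. binary_digit i u = w i)} = {u. \<lfloor>2 ^ n * u\<rfloor> = m}"
  proof (induction n)
    case (Suc n)
    then obtain m where m: "0 \<le> m" "m < 2 ^ n"
      "{u::real. \<lfloor>u\<rfloor> = 0 \<and> (\<forall>i<n. binary_digit i u = w i)} = {u. \<lfloor>2 ^ n * u\<rfloor> = m}"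
      by blast
    \<comment> \<open>The halves of dyadic interval number \<open>m\<close> have numbers
      \<open>2 * m\<close> and \<open>2 * m + 1\<close> on the next level.\<close>
    have "\<lfloor>2 ^ Suc n * u\<rfloor> = 2 * m + w n \<longleftrightarrow> \<lfloor>2 ^ n * u\<rfloor> = m \<and> binary_digit n u = w n" for u :: real
      unfolding floor_double using binary_digit_range[of n u] assms[of n] by auto presburger+
    then have "{u::real. \<lfloor>u\<rfloor> = 0 \<and> (\<forall>i<Suc n. binary_digit i u = w i)} = {u. \<lfloor>2 ^ Suc n * u\<rfloor> = 2 * m + w n}"
      using m(3) by (auto simp: less_Suc_eq set_eq_iff simp del: power_Suc)
    then show ?case
      using m(1,2) assms[of n] by (intro exI[of _ "2 * m + w n"]) auto
  qed auto
  then obtain m where "0 \<le> m" "m < 2 ^ n"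
      "{u::real. \<lfloor>u\<rfloor> = 0 \<and> (\<forall>i<n. binary_digit i u = w i)} = {u. \<lfloor>2 ^ n * u\<rfloor> = m}"
    by blast
  then show ?thesis
    using emeasure_unif_dyadic by simp
qed

text \<open>Up to a null set the event is a disjoint union of cylinders, one for each admissible
  word of length \<open>n\<close>. Each has mass \<open>2^-n\<close>, and the number of words is the
  product of the cardinalities \<open>card ({0, 1} \<inter> A i)\<close>.\<close>

lemma emeasure_unif_digit_box:
  "emeasure unif {u. \<forall>i<n. binary_digit i u \<in> A i} = (\<Prod>i<n. emeasure coin (A i))"
proof -
  let ?W = "\<Pi>\<^sub>E i\<in>{..<n}. {0, 1} \<inter> A i"
  let ?D = "\<lambda>w. {u. \<lfloor>u\<rfloor> = 0 \<and> (\<forall>i<n. binary_digit i u = w i)}"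
  have finW: "finite ?W"
    by (intro finite_PiE) auto
  have digit_sets: "{u. binary_digit i u \<in> X} \<in> sets borel" for i X
    using measurable_sets[OF measurable_binary_digit[of i], of X] by (simp add: vimage_def)
  have box_sets: "{u. \<forall>i<n. binary_digit i u \<in> X i} \<in> sets borel" for X
    using sets.sets_Collect_countable_All'[of "{..<n}" borel "\<lambda>i u. binary_digit i u \<in> X i"] digit_sets
    by (simp add: Ball_def)
  have "{u::real. \<lfloor>u\<rfloor> = 0} = {0..<1}"
    by (auto simp: floor_eq_iff)
  then have D_sets: "?D w \<in> sets borel" for w
    using box_sets[of "\<lambda>i. {w i}"] by (simp add: Collect_conj_eq sets.Int)
  have "emeasure unif {u. \<forall>i<n. binary_digit i u \<in> A i} = emeasure unif (\<Union>w\<in>?W. ?D w)"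
  proof (rule emeasure_eq_AE)
    show "AE u in unif. u \<in> {u. \<forall>i<n. binary_digit i u \<in> A i} \<longleftrightarrow> u \<in> (\<Union>w\<in>?W. ?D w)"
      using AE_unif
    proof eventually_elim
      case (elim u)
      then have f0: "\<lfloor>u\<rfloor> = 0"
        by linarith
      show ?case
      proof
        assume *: "u \<in> {u. \<forall>i<n. binary_digit i u \<in> A i}"
        show "u \<in> (\<Union>w\<in>?W. ?D w)"
        proof (rule UN_I)
          show "(\<lambda>i\<in>{..<n}. binary_digit i u) \<in> ?W"
            using * binary_digit_range by (intro restrict_PiE_iff[THEN iffD2]) blast
        qed (simp add: f0)
      qed (auto simp: PiE_iff)
    qed
    show "{u. \<forall>i<n. binary_digit i u \<in> A i} \<in> sets unif"
      using box_sets by simp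
    show "(\<Union>w\<in>?W. ?D w) \<in> sets unif"
      using D_sets finW by (intro sets.finite_UN) simp_all
  qed
  also have "\<dots> = (\<Sum>w\<in>?W. emeasure unif (?D w))"
  proof (rule sum_emeasure[symmetric])
    show "disjoint_family_on ?D ?W"
      unfolding disjoint_family_on_def
    proof (intro ballI impI)
      fix v w assume "v \<in> ?W" "w \<in> ?W" "v \<noteq> w"
      then obtain i where "i < n" "v i \<noteq> w i"
        by (metis PiE_ext lessThan_iff)
      then show "?D v \<inter> ?D w = {}"
        by auto
    qed
    show "?D ` ?W \<subseteq> sets unif"
      using D_sets by (simp add: image_subset_iff)
  qed (rule finW)
  also have "\<dots> = (\<Sum>w\<in>?W. ennreal (1 / 2 ^ n))"
  proof (rule sum.cong)
    fix w assume w: "w \<in> ?W"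
    \<comment> \<open>Words in \<open>?W\<close> are \<open>undefined\<close> from position
      \<open>n\<close> on; padding with 0 makes every letter a digit and leaves the cylinder
      unchanged.\<close>
    have "?D w = ?D (\<lambda>i. if i < n then w i else 0)"
      by simp
    also have "emeasure unif \<dots> = ennreal (1 / 2 ^ n)"
    proof (rule emeasure_unif_digits)
      show "(if i < n then w i else 0) \<in> {0, 1}" for i
        using PiE_mem[OF w, of i] by (cases "i < n") simp_all
    qed
    finally show "emeasure unif (?D w) = ennreal (1 / 2 ^ n)" .
  qed simp
  also have "\<dots> = ennreal (real (card ?W) * (1 / 2 ^ n))"
    by (subst ennreal_mult) (simp_all add: ennreal_of_nat_eq_real_of_nat)
  also have "real (card ?W) * (1 / 2 ^ n) = (\<Prod>i<n. card ({0, 1} \<inter> A i) / 2)"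
    by (subst card_PiE) (simp_all add: prod_dividef)
  also have "ennreal \<dots> = (\<Prod>i<n. emeasure coin (A i))"
    unfolding emeasure_coin by (subst prod_ennreal) simp_all
  finally show ?thesis .
qed

text \<open>A product law is determined by its boxes over finite index sets. Such a set lies in an
  initial segment, where the added positions get the constraint \<open>UNIV\<close> and hence a
  factor 1.\<close>

lemma distr_binary_digits:
  "distr unif (\<Pi>\<^sub>M i\<in>UNIV. coin) (\<lambda>u i. binary_digit i u) = (\<Pi>\<^sub>M i\<in>UNIV. coin)"
proof -
  interpret C: product_prob_space "\<lambda>_. coin" "UNIV :: nat set"
    by standard
  have [measurable]: "(\<lambda>u i. binary_digit i u) \<in> unif \<rightarrow>\<^sub>M (\<Pi>\<^sub>M i\<in>UNIV. coin)"
    by (rule measurable_PiM_single') (auto simp: space_PiM)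
  show ?thesis
  proof (rule C.PiM_eq)
    fix J :: "nat set" and F :: "nat \<Rightarrow> int set"
    assume J: "finite J"
    then obtain n where n: "J \<subseteq> {..<n}"
      using finite_nat_iff_bounded by blast
    let ?A = "\<lambda>i. if i \<in> J then F i else UNIV"
    have "emeasure (distr unif (\<Pi>\<^sub>M i\<in>UNIV. coin) (\<lambda>u i. binary_digit i u)) (C.emb UNIV J (Pi\<^sub>E J F))
      = emeasure unif ((\<lambda>u i. binary_digit i u) -` C.emb UNIV J (Pi\<^sub>E J F) \<inter> space unif)"
      using J by (intro emeasure_distr sets_PiM_I) auto
    also have "(\<lambda>u i. binary_digit i u) -` C.emb UNIV J (Pi\<^sub>E J F) \<inter> space unif
      = {u. \<forall>i<n. binary_digit i u \<in> ?A i}"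
      using n by (auto simp: prod_emb_def space_PiM PiE_iff subset_eq)
    also have "emeasure unif \<dots> = (\<Prod>i<n. emeasure coin (?A i))"
      by (rule emeasure_unif_digit_box)
    also have "\<dots> = (\<Prod>i\<in>J. emeasure coin (F i))"
      using n J by (intro prod.mono_neutral_cong_right) (auto simp: measure_pmf.emeasure_space_1[simplified])
    finally show "emeasure (distr unif (\<Pi>\<^sub>M i\<in>UNIV. coin) (\<lambda>u i. binary_digit i u)) (C.emb UNIV J (Pi\<^sub>E J F))
      = (\<Prod>i\<in>J. emeasure coin (F i))" .
  qed simp
qed

lemma measurable_binary_value_coin [measurable]:
  "binary_value \<in> (\<Pi>\<^sub>M i\<in>UNIV. coin) \<rightarrow>\<^sub>M borel"
proof -
  have "sets (\<Pi>\<^sub>M i\<in>UNIV. coin) = sets (\<Pi>\<^sub>M i\<in>(UNIV::nat set). count_space UNIV)"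
    by (intro sets_PiM_cong) auto
  then show ?thesis
    using measurable_binary_value measurable_cong_sets by blast
qed

text \<open>Since \<open>binary_value\<close> undoes the digit map almost everywhere, it carries the
  law of the digits back to the law of the number.\<close>

lemma distr_binary_value:
  "distr (\<Pi>\<^sub>M i\<in>UNIV. coin) borel binary_value = unif"
proof -
  have m: "(\<lambda>u i. binary_digit i u) \<in> unif \<rightarrow>\<^sub>M (\<Pi>\<^sub>M i\<in>UNIV. coin)"
    by (rule measurable_PiM_single') (auto simp: space_PiM)
  have "distr (\<Pi>\<^sub>M i\<in>UNIV. coin) borel binary_value
    = distr unif borel (binary_value \<circ> (\<lambda>u i. binary_digit i u))"
    by (subst distr_binary_digits[symmetric]) (rule distr_distr[OF measurable_binary_value_coin m])
  also have "\<dots> = distr unif borel (\<lambda>u. u)"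
  proof (rule distr_cong_AE)
    show "AE u in unif. (binary_value \<circ> (\<lambda>u i. binary_digit i u)) u = u"
      using AE_unif by eventually_elim (simp add: binary_value_binary_digit)
    show "binary_value \<circ> (\<lambda>u i. binary_digit i u) \<in> borel_measurable unif"
      using m measurable_binary_value_coin by (rule measurable_comp)
  qed auto
  also have "\<dots> = unif"
    by (rule distr_id2) simp
  finally show ?thesis .
qed

section \<open>Independent uniform numbers from disjoint rows of digits\<close>

text \<open>The pairing bijection \<open>prod_encode\<close> lays out the digit positions as an
  infinite table; row \<open>j\<close> of it is read as a binary expansion in its own right.\<close>

definition digit_row :: "nat \<Rightarrow> real \<Rightarrow> real" where
  "digit_row j u = binary_value (\<lambda>i. binary_digit (prod_encode (j, i)) u)"

lemma digit_row_bounds: "digit_row j u \<in> {0..1}"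
  unfolding digit_row_def by (rule binary_value_bounds) (rule binary_digit_range)

lemma measurable_digit_row [measurable]: "digit_row j \<in> borel_measurable borel"
  unfolding digit_row_def[abs_def]
  by (rule measurable_compose[OF _ measurable_binary_value]) (rule measurable_PiM_single', auto simp: space_PiM)

text \<open>Reading i.i.d. coins along an injection of the index set gives i.i.d. coins again, and
  \<open>binary_value\<close> turns these into a uniform number.\<close>

lemma distr_digit_row: "distr unif borel (digit_row j) = unif"
proof -
  let ?P = "\<Pi>\<^sub>M i\<in>(UNIV::nat set). coin"
  let ?r = "\<lambda>\<omega>. \<lambda>i\<in>UNIV. \<omega> (prod_encode (j, i))"
  have m: "(\<lambda>u i. binary_digit i u) \<in> unif \<rightarrow>\<^sub>M ?P"
    by (rule measurable_PiM_single') (auto simp: space_PiM)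
  have r: "?r \<in> ?P \<rightarrow>\<^sub>M ?P"
    by (intro measurable_restrict measurable_component_singleton) auto
  have "distr unif borel (digit_row j) = distr unif borel (binary_value \<circ> (?r \<circ> (\<lambda>u i. binary_digit i u)))"
    by (intro distr_cong) (auto simp: digit_row_def restrict_UNIV)
  also have "\<dots> = distr (distr (distr unif ?P (\<lambda>u i. binary_digit i u)) ?P ?r) borel binary_value"
    using m r measurable_binary_value_coin by (simp add: distr_distr comp_assoc)
  also have "\<dots> = unif"
    using distr_PiM_reindex[of UNIV "\<lambda>_. coin" "\<lambda>i. prod_encode (j, i)" UNIV]
    by (simp add: distr_binary_digits distr_binary_value prob_space_measure_pmf inj_on_def)
  finally show ?thesis .
qed

text \<open>Each row is a function of its own block of digits, and the blocks are disjoint because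
  \<open>prod_encode\<close> is injective.\<close>

lemma indep_digit_rows:
  "prob_space.indep_vars unif (\<lambda>_. borel) digit_row UNIV"
proof -
  interpret U: prob_space unif
    by (rule prob_space_unif)
  have digit: "distr unif coin (binary_digit n) = coin" for n
  proof -
    have "distr unif coin (binary_digit n)
      = distr (distr unif (\<Pi>\<^sub>M i\<in>UNIV. coin) (\<lambda>u i. binary_digit i u)) coin (\<lambda>\<omega>. \<omega> n)"
      by (subst distr_distr) (auto simp: comp_def intro!: measurable_PiM_single')
    then show ?thesis
      using distr_PiM_component[of UNIV "\<lambda>_. coin" n]
      by (simp add: distr_binary_digits prob_space_measure_pmf)
  qed
  have "U.indep_vars (\<lambda>_. coin) binary_digit UNIV"
    by (subst U.indep_vars_iff_distr_eq_PiM) (simp_all add: digit distr_binary_digits restrict_UNIV)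
  then have "U.indep_vars (\<lambda>j. PiM (range (\<lambda>i. prod_encode (j, i))) (\<lambda>_. coin))
      (\<lambda>j u. \<lambda>k\<in>range (\<lambda>i. prod_encode (j, i)). binary_digit k u) UNIV"
    by (rule U.indep_vars_restrict) (simp, force simp: disjoint_family_on_def)
  then have "U.indep_vars (\<lambda>_. borel)
      (\<lambda>j u. binary_value (\<lambda>i. (\<lambda>k\<in>range (\<lambda>i. prod_encode (j, i)). binary_digit k u) (prod_encode (j, i)))) UNIV"
  proof (rule U.indep_vars_compose2[where Y = "\<lambda>j \<omega>. binary_value (\<lambda>i. \<omega> (prod_encode (j, i)))"])
    fix j
    show "(\<lambda>\<omega>. binary_value (\<lambda>i. \<omega> (prod_encode (j, i)))) \<in> PiM (range (\<lambda>i. prod_encode (j, i))) (\<lambda>_. coin) \<rightarrow>\<^sub>M borel"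
    proof (rule measurable_compose[OF _ measurable_binary_value_coin], rule measurable_PiM_single')
      show "(\<lambda>\<omega>. \<omega> (prod_encode (j, i))) \<in> PiM (range (\<lambda>i. prod_encode (j, i))) (\<lambda>_. coin) \<rightarrow>\<^sub>M coin" for i
        by (rule measurable_component_singleton) auto
    qed (auto simp: space_PiM)
  qed
  moreover have "prod_encode (j, i) \<in> range (\<lambda>i. prod_encode (j, i))" for j i
    by (rule rangeI)
  ultimately show ?thesis
    unfolding digit_row_def[abs_def] by (simp only: restrict_apply')
qed

text \<open>Independence and uniform margins combined in the form of a product over finite boxes,
  which is how the i.i.d. hypothesis \<open>iid\<close> is phrased later.\<close>

lemma emeasure_digit_rows:
  assumes "finite J" "\<And>j. j \<in> J \<Longrightarrow> B j \<in> sets borel"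
  shows "emeasure unif {u. \<forall>j\<in>J. digit_row j u \<in> B j} = (\<Prod>j\<in>J. emeasure unif (B j))"
proof (cases "J = {}")
  case True
  then show ?thesis
    using prob_space.emeasure_space_1[OF prob_space_unif] by simp
next
  case False
  interpret U: prob_space unif
    by (rule prob_space_unif)
  have "emeasure unif {u. \<forall>j\<in>J. digit_row j u \<in> B j}
      = emeasure unif (\<Inter>j\<in>J. digit_row j -` B j \<inter> space unif)"
    using False by (intro arg_cong[where f = "emeasure unif"]) auto
  also have "\<dots> = (\<Prod>j\<in>J. emeasure unif (digit_row j -` B j \<inter> space unif))"
    using U.indep_varsD[OF indep_digit_rows, of J B] False assms
    by (simp add: U.emeasure_eq_measure prod_ennreal)
  also have "\<dots> = (\<Prod>j\<in>J. emeasure unif (B j))"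
  proof (rule prod.cong)
    fix j assume "j \<in> J"
    then have "emeasure unif (digit_row j -` B j \<inter> space unif) = emeasure (distr unif borel (digit_row j)) (B j)"
      using assms by (subst emeasure_distr) auto
    then show "emeasure unif (digit_row j -` B j \<inter> space unif) = emeasure unif (B j)"
      by (simp add: distr_digit_row)
  qed simp
  finally show ?thesis .
qed

section \<open>Resampling the visits\<close>

text \<open>The hypothesis \<open>cond\<close> says, free of division, that each \<open>F n\<close>
  conditioned on \<open>E\<close> is \<open>G\<close>. Integrating out \<open>y\<close> splits the
  mass of a box into one factor per coordinate, and each factor recombines as the mass of
  \<open>A i \<inter> E\<close> plus that of \<open>A i - E\<close>.\<close>

lemma distr_resample:
  assumes F: "\<And>n. prob_space (F n)" "\<And>n. sets (F n) = sets G"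
    and G: "prob_space G" and E: "E \<in> sets G"
    and cond: "\<And>n A. A \<in> sets G \<Longrightarrow> emeasure (F n) (A \<inter> E) = emeasure (F n) E * emeasure G A"
  defines "R \<equiv> \<lambda>(x, y) n. if x n \<in> E then y n else x n"
  shows "R \<in> PiM UNIV F \<Otimes>\<^sub>M PiM UNIV (\<lambda>_. G) \<rightarrow>\<^sub>M PiM (UNIV :: nat set) F"
    and "distr (PiM UNIV F \<Otimes>\<^sub>M PiM UNIV (\<lambda>_. G)) (PiM (UNIV :: nat set) F) R = PiM UNIV F"
proof -
  let ?PF = "PiM (UNIV :: nat set) F" and ?PG = "PiM (UNIV :: nat set) (\<lambda>_. G)"
  interpret F: prob_space "F n" for n
    by (rule F)
  interpret G: prob_space G
    by (rule G)
  interpret PF: product_prob_space F "UNIV :: nat set"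
    by standard
  interpret PG: product_prob_space "\<lambda>_. G" "UNIV :: nat set"
    by standard
  have space: "space (F n) = space G" for n
    using F(2) by (rule sets_eq_imp_space_eq)
  note F(2)[measurable_cong] E[measurable]
  show R: "R \<in> ?PF \<Otimes>\<^sub>M ?PG \<rightarrow>\<^sub>M ?PF"
  proof (rule measurable_PiM_single')
    show "(\<lambda>z. R z n) \<in> ?PF \<Otimes>\<^sub>M ?PG \<rightarrow>\<^sub>M F n" for n
      unfolding R_def case_prod_beta by measurable
  qed (auto simp: R_def space_pair_measure space_PiM PiE_iff space)
  show "distr (?PF \<Otimes>\<^sub>M ?PG) ?PF R = ?PF"
  proof (rule PF.PiM_eq)
    fix J :: "nat set" and A assume J: "finite J" and A: "\<And>j. j \<in> J \<Longrightarrow> A j \<in> sets (F j)"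
    \<comment> \<open>The conditional probability that the resampled coordinate lies in
      \<open>A i\<close>, given that the old value is \<open>u\<close>.\<close>
    let ?K = "\<lambda>i u. emeasure G (A i) * indicator E u + indicator (A i - E) u"
    have [measurable]: "A i \<in> sets G" if "i \<in> J" for i
      using A[OF that] F(2) by simp
    have emb: "PF.emb UNIV J (Pi\<^sub>E J A) \<in> sets ?PF"
      using J A by (intro sets_PiM_I) auto
    have "emeasure (distr (?PF \<Otimes>\<^sub>M ?PG) ?PF R) (PF.emb UNIV J (Pi\<^sub>E J A))
        = emeasure (?PF \<Otimes>\<^sub>M ?PG) (R -` PF.emb UNIV J (Pi\<^sub>E J A) \<inter> space (?PF \<Otimes>\<^sub>M ?PG))"
      using R emb by (rule emeasure_distr)
    also have "\<dots> = (\<integral>\<^sup>+x. emeasure ?PG (Pair x -` (R -` PF.emb UNIV J (Pi\<^sub>E J A) \<inter> space (?PF \<Otimes>\<^sub>M ?PG))) \<partial>?PF)"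
      by (rule PG.P.emeasure_pair_measure_alt[OF measurable_sets[OF R emb]])
    also have "\<dots> = (\<integral>\<^sup>+x. (\<Prod>i\<in>J. ?K i (x i)) \<partial>?PF)"
    proof (rule nn_integral_cong)
      fix x assume x: "x \<in> space ?PF"
      \<comment> \<open>The constraint on \<open>y i\<close> once \<open>x\<close> is fixed: off
        \<open>E\<close> the old value is kept, so \<open>y i\<close> is free if that value lies in
        \<open>A i\<close>, and no \<open>y i\<close> works otherwise.\<close>
      let ?X = "\<lambda>i. if x i \<in> E then A i else if x i \<in> A i then space G else {}"
      have "Pair x -` (R -` PF.emb UNIV J (Pi\<^sub>E J A) \<inter> space (?PF \<Otimes>\<^sub>M ?PG))
          = {y \<in> space ?PG. \<forall>i\<in>J. y i \<in> ?X i}"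
        using x unfolding R_def
        by (auto simp: prod_emb_def space_pair_measure space_PiM PiE_iff space split: if_splits)
      also have "emeasure ?PG \<dots> = (\<Prod>i\<in>J. emeasure G (?X i))"
        using J by (intro PG.emeasure_PiM_Collect) auto
      also have "\<dots> = (\<Prod>i\<in>J. ?K i (x i))"
        by (intro prod.cong) (auto simp: G.emeasure_space_1 indicator_def)
      finally show "emeasure ?PG (Pair x -` (R -` PF.emb UNIV J (Pi\<^sub>E J A) \<inter> space (?PF \<Otimes>\<^sub>M ?PG)))
        = (\<Prod>i\<in>J. ?K i (x i))" .
    qed
    \<comment> \<open>The integrand depends on the coordinates in \<open>J\<close> only; passing to
      the finite product lets the integral of the product factor.\<close>
    also have "\<dots> = (\<integral>\<^sup>+x. (\<Prod>i\<in>J. ?K i (x i)) \<partial>distr ?PF (PiM J F) (\<lambda>x. restrict x J))"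
    proof -
      have "(\<lambda>x. \<Prod>i\<in>J. ?K i (x i)) \<in> borel_measurable (PiM J F)"
        by measurable
      then have "(\<integral>\<^sup>+x. (\<Prod>i\<in>J. ?K i (x i)) \<partial>distr ?PF (PiM J F) (\<lambda>x. restrict x J))
          = (\<integral>\<^sup>+x. (\<Prod>i\<in>J. ?K i (restrict x J i)) \<partial>?PF)"
        by (intro nn_integral_distr measurable_restrict_subset) simp_all
      then show ?thesis
        by simp
    qed
    also have "\<dots> = (\<Prod>i\<in>J. \<integral>\<^sup>+u. ?K i u \<partial>F i)"
      unfolding PF.distr_PiM_restrict_finite[OF J subset_UNIV]
      using J by (intro PF.product_nn_integral_prod) measurable
    also have "\<dots> = (\<Prod>i\<in>J. emeasure (F i) (A i))"
    proof (rule prod.cong)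
      fix i assume i: "i \<in> J"
      have sets: "A i \<in> sets (F i)" "E \<in> sets (F i)"
        using A[OF i] E F(2) by auto
      have "(\<integral>\<^sup>+u. ?K i u \<partial>F i) = emeasure G (A i) * emeasure (F i) E + emeasure (F i) (A i - E)"
        using sets by (subst nn_integral_add) (auto simp: nn_integral_cmult)
      also have "\<dots> = emeasure (F i) (A i \<inter> E) + emeasure (F i) (A i - E)"
        using cond[of "A i" i] sets F(2) by (simp add: mult.commute)
      also have "\<dots> = emeasure (F i) (A i)"
        using sets by (subst plus_emeasure) (auto intro!: arg_cong[where f = "emeasure (F i)"])
      finally show "(\<integral>\<^sup>+u. ?K i u \<partial>F i) = emeasure (F i) (A i)" .
    qed simp
    finally show "emeasure (distr (?PF \<Otimes>\<^sub>M ?PG) ?PF R) (PF.emb UNIV J (Pi\<^sub>E J A)) = (\<Prod>i\<in>J. emeasure (F i) (A i))" .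
  qed simp
qed

section \<open>Infinitely many visits\<close>

text \<open>The divergence half of the Borel-Cantelli lemma: by
  \<open>1 - p \<le> exp (- p)\<close>, missing \<open>E\<close> at all of \<open>n\<close>
  successive times has probability at most the exponential of minus the sum of the visit
  probabilities.\<close>

lemma AE_PiM_infinitely_often:
  assumes F: "\<And>n. prob_space (F n)" and E: "\<And>n. E \<in> sets (F n)"
    and div: "(\<Sum>n. emeasure (F n) E) = \<infinity>"
  shows "AE x in PiM (UNIV :: nat set) F. \<forall>i. \<exists>k. x (i + k) \<in> E"
proof (subst AE_all_countable, rule allI)
  fix i
  let ?PF = "PiM (UNIV :: nat set) F"
  let ?N = "{x \<in> space ?PF. \<forall>k. x (i + k) \<notin> E}"
  let ?p = "\<lambda>n. measure (F n) E"
  interpret F: prob_space "F n" for n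
    by (rule F)
  interpret PF: product_prob_space F "UNIV :: nat set"
    by standard
  note E[measurable]
  have "?N \<in> sets ?PF"
    by measurable
  have bound: "measure ?PF ?N \<le> exp (- (\<Sum>k<n. ?p (i + k)))" for n
  proof -
    have "measure ?PF ?N \<le> measure ?PF (PF.emb UNIV ((+) i ` {..<n}) (\<Pi>\<^sub>E j\<in>(+) i ` {..<n}. space (F j) - E))"
    proof (rule PF.P.finite_measure_mono)
      show "?N \<subseteq> PF.emb UNIV ((+) i ` {..<n}) (\<Pi>\<^sub>E j\<in>(+) i ` {..<n}. space (F j) - E)"
        by (auto simp: prod_emb_def space_PiM PiE_iff)
    qed (intro sets_PiM_I, auto)
    also have "\<dots> = (\<Prod>j\<in>(+) i ` {..<n}. measure (F j) (space (F j) - E))"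
      by (rule PF.measure_PiM_emb) auto
    also have "\<dots> = (\<Prod>k<n. 1 - ?p (i + k))"
      by (subst prod.reindex) (auto simp: F.prob_compl)
    also have "\<dots> \<le> (\<Prod>k<n. exp (- ?p (i + k)))"
      by (intro prod_mono conjI exp_ge_add_one_self[THEN order_trans[rotated]]) auto
    also have "\<dots> = exp (- (\<Sum>k<n. ?p (i + k)))"
      by (simp add: exp_sum sum_negf[symmetric])
    finally show ?thesis .
  qed
  \<comment> \<open>Dropping the first \<open>i\<close> terms does not affect divergence.\<close>
  have unbounded: "\<exists>n. b < (\<Sum>k<n. ?p (i + k))" for b
  proof (rule ccontr)
    assume "\<not> ?thesis"
    then have "summable (\<lambda>k. ?p (i + k))"
      by (intro summableI_nonneg_bounded[of _ b]) (auto simp: not_less)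
    then have "summable ?p"
      using summable_iff_shift[of ?p i] by (simp add: add.commute)
    then have "(\<Sum>n. emeasure (F n) E) \<noteq> \<infinity>"
      unfolding F.emeasure_eq_measure by (subst suminf_ennreal2) auto
    with div show False
      by simp
  qed
  have "measure ?PF ?N \<le> 0"
  proof (rule field_le_epsilon)
    fix e :: real assume "0 < e"
    \<comment> \<open>Once the partial sum exceeds \<open>- ln e\<close>, the exponential bound
      falls below \<open>e\<close>.\<close>
    obtain n where "- ln e < (\<Sum>k<n. ?p (i + k))"
      using unbounded by blast
    then have "exp (- (\<Sum>k<n. ?p (i + k))) \<le> exp (ln e)"
      by simp
    with bound[of n] \<open>0 < e\<close> show "measure ?PF ?N \<le> 0 + e"
      by simp
  qed
  then have "emeasure ?PF ?N = 0"
    by (simp add: PF.P.emeasure_eq_measure measure_le_0_iff)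
  then show "AE x in ?PF. \<exists>k. x (i + k) \<in> E"
    using \<open>?N \<in> sets ?PF\<close> by (intro AE_I[of _ _ ?N]) auto
qed

section \<open>The factor map\<close>

text \<open>A visit at time \<open>i\<close> itself counts, with waiting time 0. If no visit
  follows, \<open>LEAST\<close> returns an unspecified number; under divergence this happens only on
  a null set.\<close>

definition waiting_time :: "'a set \<Rightarrow> (nat \<Rightarrow> 'a) \<Rightarrow> nat \<Rightarrow> nat" where
  "waiting_time E x i = (LEAST k. x (i + k) \<in> E)"

definition read_off :: "'a set \<Rightarrow> (nat \<Rightarrow> 'a \<Rightarrow> 'b) \<Rightarrow> (nat \<Rightarrow> 'a) \<Rightarrow> nat \<Rightarrow> 'b" where
  "read_off E h x i = h (waiting_time E x i) (x (i + waiting_time E x i))"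

text \<open>Both sides see the sequence only from time \<open>Suc i\<close> on and evaluate the same
  \<open>LEAST\<close> term, so the identity holds even at points without further visits.\<close>

lemma read_off_left_shift: "read_off E h (left_shift x) = left_shift (read_off E h x)"
  by (simp add: read_off_def waiting_time_def left_shift_def fun_eq_iff)

lemma measurable_read_off:
  assumes E: "E \<in> sets M" and h: "\<And>j. h j \<in> M \<rightarrow>\<^sub>M U"
  shows "read_off E h \<in> PiM UNIV (\<lambda>_. M) \<rightarrow>\<^sub>M PiM UNIV (\<lambda>_. U)"
proof (rule measurable_PiM_single')
  note E[measurable] h[measurable]
  have w: "(\<lambda>x. waiting_time E x i) \<in> PiM UNIV (\<lambda>_. M) \<rightarrow>\<^sub>M count_space UNIV" for i
    unfolding waiting_time_def by (rule measurable_Least) measurable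
  show r: "(\<lambda>x. read_off E h x i) \<in> PiM UNIV (\<lambda>_. M) \<rightarrow>\<^sub>M U" for i
    \<comment> \<open>For a fixed waiting time the value is a measurable function of one coordinate;
      countably many such pieces are glued.\<close>
    unfolding read_off_def by (rule measurable_compose_countable[OF _ w]) measurable
  show "read_off E h \<in> space (PiM UNIV (\<lambda>_. M)) \<rightarrow> (\<Pi>\<^sub>E i\<in>UNIV. space U)"
    using r[THEN measurable_space] by (auto simp: PiE_iff)
qed

section \<open>The law of the image sequence\<close>

text \<open>Group the indices by the position \<open>k = i + d i\<close> that they read. Different
  groups use different coordinates of \<open>y\<close>; within a group the delays
  \<open>d i = k - i\<close> are distinct, so different functions \<open>h (d i)\<close> are
  applied, and these are independent by \<open>iid\<close>.\<close>

lemma emeasure_PiM_delayed: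
  fixes h :: "nat \<Rightarrow> 'a \<Rightarrow> 'b" and d :: "nat \<Rightarrow> nat"
  assumes G: "prob_space G" and h: "\<And>j. h j \<in> G \<rightarrow>\<^sub>M U"
    and iid: "\<And>J B. finite J \<Longrightarrow> (\<And>j. j \<in> J \<Longrightarrow> B j \<in> sets U) \<Longrightarrow>
      emeasure G {u \<in> space G. \<forall>j\<in>J. h j u \<in> B j} = (\<Prod>j\<in>J. emeasure U (B j))"
    and I: "finite I" and A: "\<And>i. i \<in> I \<Longrightarrow> A i \<in> sets U"
  shows "emeasure (PiM UNIV (\<lambda>_. G)) {y \<in> space (PiM UNIV (\<lambda>_. G)). \<forall>i\<in>I. h (d i) (y (i + d i)) \<in> A i}
    = (\<Prod>i\<in>I. emeasure U (A i))"
proof -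
  interpret G: prob_space G
    by (rule G)
  interpret PG: product_prob_space "\<lambda>_. G" "UNIV :: nat set"
    by standard
  let ?I = "\<lambda>k. {i \<in> I. i + d i = k}"
  let ?K = "(\<lambda>i. i + d i) ` I"
  \<comment> \<open>At position \<open>k\<close>, function \<open>j\<close> serves the index
    \<open>k - j\<close>; the subtraction is exact because \<open>j\<close> is a delay of some index
    reading \<open>k\<close>.\<close>
  let ?X = "\<lambda>k. {u \<in> space G. \<forall>j\<in>d ` ?I k. h j u \<in> A (k - j)}"
  have inA: "A (k - j) \<in> sets U" if "j \<in> d ` ?I k" for j k
    using that A by auto
  have X_iff: "y k \<in> ?X k \<longleftrightarrow> (\<forall>i\<in>?I k. h (d i) (y (i + d i)) \<in> A i)"
    if "y \<in> space (PiM UNIV (\<lambda>_. G))" for y k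
  proof -
    have "y k \<in> ?X k \<longleftrightarrow> (\<forall>i\<in>?I k. h (d i) (y k) \<in> A (k - d i))"
      using that by (simp add: space_PiM PiE_iff)
    also have "\<dots> \<longleftrightarrow> (\<forall>i\<in>?I k. h (d i) (y (i + d i)) \<in> A i)"
      by (intro ball_cong refl) auto
    finally show ?thesis .
  qed
  have "{y \<in> space (PiM UNIV (\<lambda>_. G)). \<forall>i\<in>I. h (d i) (y (i + d i)) \<in> A i}
      = {y \<in> space (PiM UNIV (\<lambda>_. G)). \<forall>k\<in>?K. y k \<in> ?X k}"
    using X_iff by (intro Collect_cong conj_cong refl) auto
  then have "emeasure (PiM UNIV (\<lambda>_. G)) {y \<in> space (PiM UNIV (\<lambda>_. G)). \<forall>i\<in>I. h (d i) (y (i + d i)) \<in> A i}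
      = emeasure (PiM UNIV (\<lambda>_. G)) {y \<in> space (PiM UNIV (\<lambda>_. G)). \<forall>k\<in>?K. y k \<in> ?X k}"
    by (rule arg_cong)
  also have "\<dots> = (\<Prod>k\<in>?K. emeasure G (?X k))"
  proof (rule PG.emeasure_PiM_Collect)
    show "?X k \<in> sets G" for k
    proof (rule sets.sets_Collect_finite_All)
      fix j assume "j \<in> d ` ?I k"
      then show "{u \<in> space G. h j u \<in> A (k - j)} \<in> sets G"
        using measurable_sets[OF h inA, of j k] by (simp add: vimage_def Int_def conj_commute)
    qed (use I in simp)
  qed (use I in auto)
  also have "\<dots> = (\<Prod>k\<in>?K. \<Prod>i\<in>?I k. emeasure U (A i))"
  proof (rule prod.cong)
    fix k
    have fin: "finite (d ` ?I k)"
      using I by simp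
    have "emeasure G (?X k) = (\<Prod>j\<in>d ` ?I k. emeasure U (A (k - j)))"
      using fin inA[of _ k] by (rule iid[of "d ` ?I k" "\<lambda>j. A (k - j)"])
    \<comment> \<open>On one group the delay determines the index, as
      \<open>i + d i = k\<close>.\<close>
    also have "\<dots> = (\<Prod>i\<in>?I k. emeasure U (A (k - d i)))"
      by (rule prod.reindex_cong[OF _ refl refl]) (rule inj_onI, simp)
    also have "\<dots> = (\<Prod>i\<in>?I k. emeasure U (A i))"
      by (rule prod.cong) auto
    finally show "emeasure G (?X k) = (\<Prod>i\<in>?I k. emeasure U (A i))" .
  qed simp
  also have "\<dots> = (\<Prod>i\<in>I. emeasure U (A i))"
    by (rule prod.group[OF I finite_imageI[OF I] subset_refl])
  finally show ?thesis .
qed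

text \<open>After resampling, integrate over \<open>y\<close> first. For almost every
  \<open>x\<close> the waiting times are constants on the fibre, so
  \<open>emeasure_PiM_delayed\<close> gives its mass, and the result does not depend on
  \<open>x\<close>.\<close>

lemma distr_read_off:
  fixes h :: "nat \<Rightarrow> 'a \<Rightarrow> 'b"
  assumes F: "\<And>n. prob_space (F n)" "\<And>n. sets (F n) = sets G"
    and G: "prob_space G" and U: "prob_space U" and E: "E \<in> sets G" "AE u in G. u \<in> E"
    and cond: "\<And>n A. A \<in> sets G \<Longrightarrow> emeasure (F n) (A \<inter> E) = emeasure (F n) E * emeasure G A"
    and div: "(\<Sum>n. emeasure (F n) E) = \<infinity>"
    and h: "\<And>j. h j \<in> G \<rightarrow>\<^sub>M U"
    and iid: "\<And>J B. finite J \<Longrightarrow> (\<And>j. j \<in> J \<Longrightarrow> B j \<in> sets U) \<Longrightarrow>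
      emeasure G {u \<in> space G. \<forall>j\<in>J. h j u \<in> B j} = (\<Prod>j\<in>J. emeasure U (B j))"
  shows "distr (PiM UNIV F) (PiM UNIV (\<lambda>_. U)) (read_off E h) = PiM UNIV (\<lambda>_. U)"
proof -
  let ?PF = "PiM (UNIV :: nat set) F" and ?PG = "PiM (UNIV :: nat set) (\<lambda>_. G)"
  let ?PU = "PiM (UNIV :: nat set) (\<lambda>_. U)"
  define R :: "(nat \<Rightarrow> 'a) \<times> (nat \<Rightarrow> 'a) \<Rightarrow> nat \<Rightarrow> 'a"
    where "R = (\<lambda>(x, y) n. if x n \<in> E then y n else x n)"
  have R: "R \<in> ?PF \<Otimes>\<^sub>M ?PG \<rightarrow>\<^sub>M ?PF" and distr_R: "distr (?PF \<Otimes>\<^sub>M ?PG) ?PF R = ?PF"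
    unfolding R_def using distr_resample[of F G E] F G E(1) cond by blast+
  interpret F: prob_space "F n" for n
    by (rule F)
  interpret G: prob_space G
    by (rule G)
  interpret U: prob_space U
    by (rule U)
  interpret PF: product_prob_space F "UNIV :: nat set"
    by standard
  interpret PG: product_prob_space "\<lambda>_. G" "UNIV :: nat set"
    by standard
  interpret PU: product_prob_space "\<lambda>_. U" "UNIV :: nat set"
    by standard
  have "sets ?PF = sets ?PG"
    using F(2) by (intro sets_PiM_cong) auto
  then have "?PF \<rightarrow>\<^sub>M ?PU = ?PG \<rightarrow>\<^sub>M ?PU"
    by (rule measurable_cong_sets) simp
  then have r: "read_off E h \<in> ?PF \<rightarrow>\<^sub>M ?PU"
    using measurable_read_off[OF E(1) h] by simp
  have visits: "AE x in ?PF. \<forall>i. \<exists>k. x (i + k) \<in> E"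
    using F E(1) div by (intro AE_PiM_infinitely_often) auto
  \<comment> \<open>Fresh samples stay in \<open>E\<close>, so resampling moves no visit.\<close>
  have inE: "AE y in ?PG. \<forall>k. y k \<in> E"
    using E(2) by (subst AE_all_countable) (intro allI PG.AE_component UNIV_I)
  show ?thesis
  proof (rule PU.PiM_eq)
    fix J :: "nat set" and A assume J: "finite J" and A: "\<And>j. j \<in> J \<Longrightarrow> A j \<in> sets U"
    have emb: "PU.emb UNIV J (Pi\<^sub>E J A) \<in> sets ?PU"
      using J A by (intro sets_PiM_I) auto
    let ?S = "read_off E h -` PU.emb UNIV J (Pi\<^sub>E J A) \<inter> space ?PF"
    let ?RS = "R -` ?S \<inter> space (?PF \<Otimes>\<^sub>M ?PG)"
    have S: "?S \<in> sets ?PF"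
      using r emb by (rule measurable_sets)
    have RS: "?RS \<in> sets (?PF \<Otimes>\<^sub>M ?PG)"
      using R S by (rule measurable_sets)
    have "emeasure (distr ?PF ?PU (read_off E h)) (PU.emb UNIV J (Pi\<^sub>E J A)) = emeasure ?PF ?S"
      using r emb by (rule emeasure_distr)
    also have "\<dots> = emeasure (?PF \<Otimes>\<^sub>M ?PG) ?RS"
      by (subst distr_R[symmetric]) (rule emeasure_distr[OF R S])
    also have "\<dots> = (\<integral>\<^sup>+x. emeasure ?PG (Pair x -` ?RS) \<partial>?PF)"
      using RS by (rule PG.P.emeasure_pair_measure_alt)
    also have "\<dots> = (\<integral>\<^sup>+x. (\<Prod>i\<in>J. emeasure U (A i)) \<partial>?PF)"
    proof (rule nn_integral_cong_AE)
      show "AE x in ?PF. emeasure ?PG (Pair x -` ?RS) = (\<Prod>i\<in>J. emeasure U (A i))"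
        using visits AE_space
      proof eventually_elim
        case (elim x)
        let ?d = "waiting_time E x"
        let ?Y = "{y \<in> space ?PG. \<forall>i\<in>J. h (?d i) (y (i + ?d i)) \<in> A i}"
        \<comment> \<open>A later visit exists, so the least waiting time is attained and the value
          read there is one of those replaced by \<open>y\<close>.\<close>
        have hit: "x (i + ?d i) \<in> E" for i
          unfolding waiting_time_def using elim(1) by (metis (mono_tags, lifting) LeastI_ex)
        have "emeasure ?PG (Pair x -` ?RS) = emeasure ?PG ?Y"
        proof (rule emeasure_eq_AE)
          show "AE y in ?PG. y \<in> Pair x -` ?RS \<longleftrightarrow> y \<in> ?Y"
            using inE AE_space
          proof eventually_elim
            case (elim y)
            have "waiting_time E (R (x, y)) = ?d"
              using elim(1) by (simp add: waiting_time_def R_def fun_eq_iff)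
            then have eq: "read_off E h (R (x, y)) i = h (?d i) (y (i + ?d i))" for i
              using hit[of i] by (simp add: read_off_def R_def)
            have xy: "(x, y) \<in> space (?PF \<Otimes>\<^sub>M ?PG)"
              using elim(2) \<open>x \<in> space ?PF\<close> by (simp add: space_pair_measure)
            have Rxy: "R (x, y) \<in> space ?PF"
              using R xy by (rule measurable_space)
            have "y \<in> Pair x -` ?RS \<longleftrightarrow> read_off E h (R (x, y)) \<in> PU.emb UNIV J (Pi\<^sub>E J A)"
              using xy Rxy by simp
            also have "\<dots> \<longleftrightarrow> (\<forall>i\<in>J. read_off E h (R (x, y)) i \<in> A i)"
              using measurable_space[OF r Rxy] by (auto simp: prod_emb_def space_PiM PiE_iff)
            finally show ?case
              using elim(2) by (simp add: eq)
          qed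
          show "Pair x -` ?RS \<in> sets ?PG"
            using RS by (rule sets_Pair1)
          show "?Y \<in> sets ?PG"
          proof (rule sets.sets_Collect_finite_All)
            fix i assume "i \<in> J"
            have "(\<lambda>y. h (?d i) (y (i + ?d i))) \<in> ?PG \<rightarrow>\<^sub>M U"
              by (rule measurable_compose[OF _ h]) (rule measurable_component_singleton[OF UNIV_I])
            from measurable_sets[OF this A[OF \<open>i \<in> J\<close>]]
            show "{y \<in> space ?PG. h (?d i) (y (i + ?d i)) \<in> A i} \<in> sets ?PG"
              by (simp add: vimage_def Int_def conj_commute)
          qed (rule J)
        qed
        also have "\<dots> = (\<Prod>i\<in>J. emeasure U (A i))"
          using G h iid J A by (rule emeasure_PiM_delayed)
        finally show ?case .
      qed
    qed
    also have "\<dots> = (\<Prod>i\<in>J. emeasure U (A i))"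
      by (simp add: PF.P.emeasure_space_1)
    finally show "emeasure (distr ?PF ?PU (read_off E h)) (PU.emb UNIV J (Pi\<^sub>E J A)) = (\<Prod>j\<in>J. emeasure U (A j))" .
  qed simp
qed

section \<open>Densities on the real line\<close>

lemma prob_density_fun_prob_space:
  assumes "prob_density_fun f"
  shows "prob_space (density lborel (\<lambda>u. ennreal (f u)))"
proof (rule prob_spaceI)
  have f: "f \<in> borel_measurable borel" "\<And>u. 0 \<le> f u" "has_bochner_integral lborel f 1"
    using assms unfolding prob_density_fun_def by auto
  have "(\<integral>\<^sup>+u. ennreal (f u) \<partial>lborel) = ennreal 1"
    using f by (intro nn_integral_eq_integral[THEN trans])
      (auto simp: has_bochner_integral_iff)
  then show "emeasure (density lborel (\<lambda>u. ennreal (f u))) (space (density lborel (\<lambda>u. ennreal (f u)))) = 1"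
    using f(1) by (simp add: emeasure_density)
qed

text \<open>Translates the real-valued integrals of the hypotheses into the masses used for the
  product measures.\<close>

lemma emeasure_density_on:
  assumes f: "prob_density_fun f" and E: "E \<in> sets borel"
  shows "emeasure (density lborel (\<lambda>u. ennreal (f u))) E = ennreal (LINT u:E|lborel. f u)"
proof -
  have *: "f \<in> borel_measurable borel" "\<And>u. 0 \<le> f u" "integrable lborel f"
    using f unfolding prob_density_fun_def by (auto simp: has_bochner_integral_iff)
  have "integrable lborel (\<lambda>u. indicator E u *\<^sub>R f u)"
    using * E by (intro integrable_mult_indicator) auto
  moreover have "(\<integral>\<^sup>+u. ennreal (f u) * indicator E u \<partial>lborel) = (\<integral>\<^sup>+u. ennreal (indicator E u *\<^sub>R f u) \<partial>lborel)"
    by (intro nn_integral_cong) (simp add: indicator_def)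
  ultimately show ?thesis
    using * E unfolding set_lebesgue_integral_def
    by (subst emeasure_density) (simp_all add: nn_integral_eq_integral)
qed

text \<open>Verifies \<open>cond\<close> for densities: almost everywhere \<open>f\<close> times the
  indicator of \<open>E\<close> equals \<open>g\<close> times the mass that \<open>f\<close> gives
  to \<open>E\<close>, and this mass is positive, so its inverse can be cleared.\<close>

lemma emeasure_cond_density:
  assumes f: "prob_density_fun f" and g: "prob_density_fun g" and fg: "has_cond_density f E g"
    and E: "E \<in> sets borel" and A: "A \<in> sets borel"
  shows "emeasure (density lborel (\<lambda>u. ennreal (f u))) (A \<inter> E)
    = emeasure (density lborel (\<lambda>u. ennreal (f u))) E * emeasure (density lborel (\<lambda>u. ennreal (g u))) A"
proof -
  let ?p = "LINT u:E|lborel. f u"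
  have p: "?p > 0" and ae: "AE u in lborel. inverse ?p * (f u * indicator E u) = g u"
    using fg unfolding has_cond_density_def cond_density_def by auto
  have meas [measurable]: "f \<in> borel_measurable borel" "g \<in> borel_measurable borel" "A \<in> sets borel" "E \<in> sets borel"
    using f g E A unfolding prob_density_fun_def by auto
  have "emeasure (density lborel (\<lambda>u. ennreal (f u))) (A \<inter> E) = (\<integral>\<^sup>+u. ennreal (f u) * indicator (A \<inter> E) u \<partial>lborel)"
    by (rule emeasure_density) measurable
  also have "\<dots> = (\<integral>\<^sup>+u. ennreal ?p * (ennreal (g u) * indicator A u) \<partial>lborel)"
  proof (rule nn_integral_cong_AE)
    show "AE u in lborel. ennreal (f u) * indicator (A \<inter> E) u = ennreal ?p * (ennreal (g u) * indicator A u)"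
      using ae
    proof eventually_elim
      case (elim u)
      then have "?p * g u = f u * indicator E u"
        using p by (simp add: field_simps)
      then have "ennreal ?p * ennreal (g u) = ennreal (f u * indicator E u)"
        using p by (metis ennreal_mult' less_imp_le)
      then show ?case
        by (simp add: mult.assoc[symmetric] indicator_def)
    qed
  qed
  also have "\<dots> = ennreal ?p * emeasure (density lborel (\<lambda>u. ennreal (g u))) A"
    by (subst nn_integral_cmult) (simp_all add: emeasure_density)
  finally show ?thesis
    using emeasure_density_on[OF f E] by simp
qed

lemma AE_density_has_support:
  assumes g: "prob_density_fun g" and "density_has_support g E"
  shows "AE u in density lborel (\<lambda>u. ennreal (g u)). u \<in> E"
proof (subst AE_density)
  show "(\<lambda>u. ennreal (g u)) \<in> borel_measurable lborel"
    using g unfolding prob_density_fun_def by auto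
  show "AE u in lborel. 0 < ennreal (g u) \<longrightarrow> u \<in> E"
    using assms(2) unfolding density_has_support_def by eventually_elim auto
qed

text \<open>A law with a density has no atoms, so its distribution function produces a uniform
  number, whose digit rows are then i.i.d. uniform. These are the functions read off at the
  visits.\<close>

lemma iid_uniforms_from_density:
  assumes g: "prob_density_fun g"
  defines "G \<equiv> density lborel (\<lambda>u. ennreal (g u))"
  shows "(\<lambda>u. digit_row j (cdf G u)) \<in> borel \<rightarrow>\<^sub>M restrict_space borel {0..1}"
    and "finite J \<Longrightarrow> (\<And>j. j \<in> J \<Longrightarrow> B j \<in> sets (restrict_space lborel {0..1})) \<Longrightarrow>
      emeasure G {u \<in> space G. \<forall>j\<in>J. digit_row j (cdf G u) \<in> B j}
      = (\<Prod>j\<in>J. emeasure (restrict_space lborel {0..1}) (B j))"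
proof -
  have [measurable]: "g \<in> borel_measurable borel"
    using g unfolding prob_density_fun_def by simp
  interpret G: prob_space G
    unfolding G_def using g by (rule prob_density_fun_prob_space)
  interpret G: real_distribution G
    by standard (auto simp: G_def)
  have "measure G {x} = 0" for x
  proof -
    have "emeasure G {x} = (\<integral>\<^sup>+u. ennreal (g u) * indicator {x} u \<partial>lborel)"
      unfolding G_def by (rule emeasure_density) auto
    also have "\<dots> = (\<integral>\<^sup>+u. 0 \<partial>(lborel :: real measure))"
    proof (rule nn_integral_cong_AE)
      show "AE u in lborel. ennreal (g u) * indicator {x} u = 0"
        using AE_lborel_singleton[of x] by eventually_elim simp
    qed
    finally show ?thesis
      by (simp add: measure_def)
  qed
  then have unif: "distr G borel (cdf G) = unif"
    by (rule G.distr_cdf_uniform)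
  have cdf: "cdf G \<in> borel \<rightarrow>\<^sub>M borel"
    by (intro borel_measurable_mono monoI G.cdf_nondecreasing)
  have cdf_G: "cdf G \<in> G \<rightarrow>\<^sub>M borel"
    using cdf by (rule G.measurable_finite_borel)
  show "(\<lambda>u. digit_row j (cdf G u)) \<in> borel \<rightarrow>\<^sub>M restrict_space borel {0..1}"
    using cdf measurable_digit_row digit_row_bounds
    by (intro measurable_restrict_space2 measurable_compose[OF cdf measurable_digit_row]) auto
  assume J: "finite J"
    and B: "\<And>j. j \<in> J \<Longrightarrow> B j \<in> sets (restrict_space lborel {0..1::real})"
  have B': "B j \<in> sets borel" "B j \<subseteq> {0..1}" if "j \<in> J" for j
    using B[OF that] by (auto simp: sets_restrict_space_iff)
  let ?V = "{v. \<forall>j\<in>J. digit_row j v \<in> B j}"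
  have V: "?V \<in> sets borel"
  proof -
    have "{v. digit_row j v \<in> B j} \<in> sets borel" if "j \<in> J" for j
      using measurable_sets[OF measurable_digit_row B'(1)[OF that], of j] by (simp add: vimage_def)
    then show ?thesis
      using sets.sets_Collect_finite_All[of J borel "\<lambda>j v. digit_row j v \<in> B j"] J by simp
  qed
  have "emeasure G {u \<in> space G. \<forall>j\<in>J. digit_row j (cdf G u) \<in> B j} = emeasure (distr G borel (cdf G)) ?V"
    by (subst emeasure_distr[OF cdf_G V]) (auto intro!: arg_cong[where f = "emeasure G"])
  also have "\<dots> = (\<Prod>j\<in>J. emeasure unif (B j))"
    unfolding unif using J B'(1) by (rule emeasure_digit_rows)
  \<comment> \<open>The sets \<open>B j\<close> lie in the unit interval, which has length 1, so
    restricting and conditioning Lebesgue measure agree on them.\<close>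
  also have "\<dots> = (\<Prod>j\<in>J. emeasure (restrict_space lborel {0..1}) (B j))"
  proof (rule prod.cong)
    fix j assume "j \<in> J"
    from B'[OF this] show "emeasure unif (B j) = emeasure (restrict_space lborel {0..1}) (B j)"
      by (simp add: emeasure_restrict_space divide_ennreal_def Int_absorb1)
  qed simp
  finally show "emeasure G {u \<in> space G. \<forall>j\<in>J. digit_row j (cdf G u) \<in> B j}
    = (\<Prod>j\<in>J. emeasure (restrict_space lborel {0..1}) (B j))" .
qed

theorem theorem5:
  fixes E :: "real set" and g :: "real \<Rightarrow> real"
  assumes "E \<in> sets borel" and "E \<subseteq> {0..1}"
    and "prob_density_fun g" and "density_has_support g E"
  shows "\<exists>\<phi> \<in> (\<Pi>\<^sub>M n\<in>(UNIV :: nat set). (borel :: real measure)) \<rightarrow>\<^sub>M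
               (\<Pi>\<^sub>M n\<in>(UNIV :: nat set). restrict_space (borel :: real measure) {0..1}).
           \<forall>f :: nat \<Rightarrow> real \<Rightarrow> real.
             (\<forall>n. prob_density_fun (f n)) \<longrightarrow>
             (\<forall>n. has_cond_density (f n) E g) \<longrightarrow>
             (\<Sum>n. ennreal (LINT u:E|lborel. f n u)) = \<infinity> \<longrightarrow>
             nonsingular_map (bernoulli_measure f) left_shift \<longrightarrow>
             measure_preserving_factor \<phi>
               (bernoulli_measure f) left_shift iid_uniform_measure left_shift"
proof -
  note E = assms(1) and g = assms(3)
  define G where "G = density lborel (\<lambda>u. ennreal (g u))"
  let ?U = "restrict_space lborel {0..1::real}"
  \<comment> \<open>Built from \<open>g\<close> alone, before any sequence \<open>f\<close> is
    introduced; hence one map \<open>read_off E h\<close> serves all admissible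
    \<open>f\<close>.\<close>
  define h where "h = (\<lambda>j u. digit_row j (cdf G u))"
  have h: "h j \<in> borel \<rightarrow>\<^sub>M restrict_space borel {0..1}" for j
    unfolding h_def G_def using g by (rule iid_uniforms_from_density(1))
  have iid: "emeasure G {u \<in> space G. \<forall>j\<in>J. h j u \<in> B j} = (\<Prod>j\<in>J. emeasure ?U (B j))"
    if "finite J" "\<And>j. j \<in> J \<Longrightarrow> B j \<in> sets ?U" for J B
    unfolding h_def G_def using g that by (rule iid_uniforms_from_density(2))
  have sets_U: "sets ?U = sets (restrict_space borel {0..1})"
    by (intro sets_restrict_space_cong) simp
  have sets_G: "sets G = sets borel"
    by (simp add: G_def)
  have \<phi>: "read_off E h \<in> PiM UNIV (\<lambda>_. borel) \<rightarrow>\<^sub>M PiM UNIV (\<lambda>_. restrict_space borel {0..1})"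
    using E h by (rule measurable_read_off)
  show ?thesis
  proof (intro bexI[OF _ \<phi>] allI impI)
    fix f
    assume f: "\<forall>n. prob_density_fun (f n)" and fg: "\<forall>n. has_cond_density (f n) E g"
      and div: "(\<Sum>n. ennreal (LINT u:E|lborel. f n u)) = \<infinity>"
    define F where "F = (\<lambda>n. density lborel (\<lambda>u. ennreal (f n u)))"
    have PF: "bernoulli_measure f = PiM UNIV F" and PU: "iid_uniform_measure = PiM UNIV (\<lambda>_. ?U)"
      unfolding bernoulli_measure_def iid_uniform_measure_def F_def by auto
    \<comment> \<open>The Bernoulli measure has the product Borel sets as its measurable sets
      whatever \<open>f\<close> is, so measurability of the fixed map carries over.\<close>
    have "sets (PiM (UNIV :: nat set) F) = sets (PiM UNIV (\<lambda>_. borel))"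
      by (intro sets_PiM_cong) (auto simp: F_def)
    moreover have "sets (PiM (UNIV :: nat set) (\<lambda>_. ?U)) = sets (PiM UNIV (\<lambda>_. restrict_space borel {0..1}))"
      by (intro sets_PiM_cong sets_U) auto
    ultimately have "PiM UNIV F \<rightarrow>\<^sub>M PiM (UNIV :: nat set) (\<lambda>_. ?U)
        = PiM UNIV (\<lambda>_. borel) \<rightarrow>\<^sub>M PiM UNIV (\<lambda>_. restrict_space borel {0..1})"
      by (rule measurable_cong_sets)
    with \<phi> have "read_off E h \<in> PiM UNIV F \<rightarrow>\<^sub>M PiM UNIV (\<lambda>_. ?U)"
      by simp
    moreover have "distr (PiM UNIV F) (PiM UNIV (\<lambda>_. ?U)) (read_off E h) = PiM UNIV (\<lambda>_. ?U)"
    proof (rule distr_read_off)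
      show "prob_space (F n)" "sets (F n) = sets G" for n
        using f by (auto simp: F_def sets_G intro: prob_density_fun_prob_space)
      show "prob_space G"
        unfolding G_def using g by (rule prob_density_fun_prob_space)
      show "prob_space ?U"
        by (rule prob_spaceI) (simp add: emeasure_restrict_space space_restrict_space)
      show "E \<in> sets G"
        using E sets_G by simp
      show "AE u in G. u \<in> E"
        unfolding G_def using g assms(4) by (rule AE_density_has_support)
      show "emeasure (F n) (A \<inter> E) = emeasure (F n) E * emeasure G A" if "A \<in> sets G" for n A
        unfolding F_def G_def using f g fg E that sets_G by (intro emeasure_cond_density) auto
      show "(\<Sum>n. emeasure (F n) E) = \<infinity>"
        using div f E by (simp add: F_def emeasure_density_on)
      show "h j \<in> G \<rightarrow>\<^sub>M ?U" for j
        using h[of j] measurable_cong_sets[OF sets_G sets_U] by simp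
    qed (rule iid)
    ultimately show "measure_preserving_factor (read_off E h) (bernoulli_measure f) left_shift
        iid_uniform_measure left_shift"
      unfolding measure_preserving_factor_def PF PU by (simp add: read_off_left_shift)
  qed
qed

end
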